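(* Let $\Sigma=(X,\mathcal{U},\phi)$ be an ordered control system that is monotone (with respect to states and inputs). Let $\mathcal{U}_c\subset\mathcal{U}$ and let the following two conditions hold: (i) There exists $\rho\in\mathcal{K}_\infty$ such that for any $x_-,x,x_+\in X$ satisfying $x_-\le x\le x_+$ it holds that $\|x\|_X\le\rho(\|x_-\|_X+\|x_+\|_X)$. (ii) There exist $\eta,\xi\in\mathcal{K}_\infty$ such that for every $x\in X$, every $u\in\mathcal{U}(x)$ and every $\varepsilon>0$ there exist $x_-,x_+\in X$ and $u_-\in\mathcal{U}(x_-)\cap\mathcal{U}_c$, $u_+\in\mathcal{U}(x_+)\cap\mathcal{U}_c$ satisfying $x_-\le x\le x_+$, $u_-\le u\le u_+$ and $$\max\left(\|u_-\|_{\mathcal{U}},\|u_+\|_{\mathcal{U}}\right)\le\eta\left(\|u\|_{\mathcal{U}}+\varepsilon\right),$$ $$\max\left(\|x_-\|_X,\|x_+\|_X\right)\le\xi\left(\|x\|_X+\|u\|_{\mathcal{U}}+\varepsilon\right).$$ Then $\Sigma$ is ISS if and only if $\Sigma$ is ISS with respect to inputs in $\mathcal{U}_c$. Moreover, if $\rho$ and $\xi$ are linear, then $\Sigma$ is exp-ISS if and only if $\Sigma$ is exp-ISS with respect to inputs in $\mathcal{U}_c$. If additionally $\Sigma$ is exp-ISS with respect to inputs in $\mathcal{U}_c$ with a linear gain function and $\eta$ is linear, then $\Sigma$ is exp-ISS with a linear gain function.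
   Context: Comparison functions ($\mathbb{R}_+=[0,\infty)$): $\mathcal{K}$ is the set of continuous strictly increasing $\gamma:\mathbb{R}_+\to\mathbb{R}_+$ with $\gamma(0)=0$; $\mathcal{K}_\infty$ is the set of unbounded $\gamma\in\mathcal{K}$; $\mathcal{L}$ is the set of continuous strictly decreasing $\gamma:\mathbb{R}_+\to\mathbb{R}_+$ with $\lim_{t\to\infty}\gamma(t)=0$; $\mathcal{KL}$ is the set of continuous $\beta:\mathbb{R}_+\times\mathbb{R}_+\to\mathbb{R}_+$ with $\beta(\cdot,t)\in\mathcal{K}$ for all $t\ge0$ and $\beta(r,\cdot)\in\mathcal{L}$ for all $r>0$. Control system: a triple $\Sigma=(X,\mathcal{U},\phi)$ consisting of a normed linear space $(X,\|\cdot\|_X)$ (state space); a set $U$ of input values, which is a nonempty subset of a normed linear space; a normed linear space of inputs $\mathcal{U}\subset\{f:\mathbb{R}_+\to U\}$ with norm $\|\cdot\|_{\mathcal{U}}$, such that $u(\cdot+\tau)\in\mathcal{U}$ for all $u\in\mathcal{U}$, $\tau\ge0$; a family of nonempty sets $\mathcal{U}(x)\subset\mathcal{U}$, $x\in X$ (inputs admissible for the state $x$); and a transition map $\phi$, such that: ($\Sigma1$) $\phi(t,x,u)\in X$ is well defined for all $x\in X$, $u\in\mathcal{U}(x)$, $t\ge0$; ($\Sigma2$) $\phi(0,x,u)=x$ for all $x\in X$, $u\in\mathcal{U}(x)$; ($\Sigma3$) for all $t\ge 0$, $x\in X$, $u,\tilde u\in\mathcal{U}(x)$ with $u(s)=\tilde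 u(s)$ for $s\in[0,t]$ it holds that $\phi(t,x,u)=\phi(t,x,\tilde u)$; ($\Sigma4$) for all $t,h\ge0$, $x\in X$, $u\in\mathcal{U}(x)$ we have $u(t+\cdot)\in\mathcal{U}(\phi(t,x,u))$ and $\phi(h,\phi(t,x,u),u(t+\cdot))=\phi(t+h,x,u)$. Order: a positive cone in a normed linear space $X$ is a set $K\subset X$ with $K\cap(-K)=\{0\}$ that is closed under addition and under multiplication by scalars in $\mathbb{R}_+$; it induces the order $x\le y\Leftrightarrow y-x\in K$, and $X$ with such a cone is an ordered normed linear space. A control system is ordered if $X$ and $\mathcal{U}$ are ordered normed linear spaces. An ordered control system is monotone (with respect to states and inputs) if $\phi(t,x_1,u_1)\le\phi(t,x_2,u_2)$ for all $t\ge0$, all $x_1,x_2\in X$ with $x_1\le x_2$ and all $u_1\in\mathcal{U}(x_1)$, $u_2\in\mathcal{U}(x_2)$ with $u_1\le u_2$. Stability: $\Sigma$ is ISS with respect to inputs in $\mathcal{U}_c\subset\mathcal{U}$ if there exist $\beta\in\mathcal{KL}$, $\gamma\in\mathcal{K}$ such that for every $x\in X$ with $\mathcal{U}(x)\cap\mathcal{U}_c\neq\emptyset$, all $u\in\mathcal{U}(x)\cap\mathcal{U}_c$ and all $t\ge0$: $\|\phi(t,x,u)\|_X\le\beta(\|x\|_X,t)+\gamma(\|u\|_{\mathcal{U}})$. $\Sigma$ is exp-ISS with respect to inputs in $\mathcal{U}_c$ if there exist constants $M,\lambda>0$ and $\gamma\in\mathcal{K}_\infty$ such that, for all the same $x,u,t$,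 $\|\phi(t,x,u)\|_X\le Me^{-\lambda t}\|x\|_X+\gamma(\|u\|_{\mathcal{U}})$; it is so with a linear gain function if moreover $\gamma$ can be chosen linear. $\Sigma$ is ISS (exp-ISS, exp-ISS with a linear gain function) if this holds with $\mathcal{U}_c=\mathcal{U}$. *)

theory Defs
  imports "HOL-Analysis.Analysis" "HOL-Library.Function_Algebras"
begin

section \<open>Comparison functions\<close>

text \<open>
  A function on the half-line \<open>[0, \<infinity>)\<close> is represented by a function on \<^typ>\<open>real\<close> of which
  only the values at nonnegative arguments matter.
\<close>

definition class_K :: "(real \<Rightarrow> real) set" where
  "class_K = {\<gamma>. \<gamma> \<in> {0..} \<rightarrow> {0..} \<and> continuous_on {0..} \<gamma> \<and> strict_mono_on {0..} \<gamma> \<and> \<gamma> 0 = 0}"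

definition class_Kinf :: "(real \<Rightarrow> real) set" where
  "class_Kinf = {\<gamma> \<in> class_K. \<not> bounded (\<gamma> ` {0..})}"

definition class_L :: "(real \<Rightarrow> real) set" where
  "class_L = {\<gamma>. \<gamma> \<in> {0..} \<rightarrow> {0..} \<and> continuous_on {0..} \<gamma> \<and>
     strict_antimono_on {0..} \<gamma> \<and> (\<gamma> \<longlongrightarrow> 0) at_top}"

definition class_KL :: "(real \<Rightarrow> real \<Rightarrow> real) set" where
  "class_KL = {\<beta>. continuous_on ({0..} \<times> {0..}) (\<lambda>(r, t). \<beta> r t) \<and>
     (\<forall>r\<ge>0. \<forall>t\<ge>0. 0 \<le> \<beta> r t) \<and>
     (\<forall>t\<ge>0. (\<lambda>r. \<beta> r t) \<in> class_K) \<and>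
     (\<forall>r>0. \<beta> r \<in> class_L)}"

definition linear_on_nonneg :: "(real \<Rightarrow> real) \<Rightarrow> bool" where
  "linear_on_nonneg \<gamma> \<longleftrightarrow> (\<exists>c. \<forall>r\<ge>0. \<gamma> r = c * r)"

section \<open>Function spaces, norms on subspaces, and cones\<close>

text \<open>The pointwise vector space structure on functions into a real vector space.\<close>

instantiation "fun" :: (type, real_vector) real_vector
begin

definition scaleR_fun :: "real \<Rightarrow> ('a \<Rightarrow> 'b) \<Rightarrow> 'a \<Rightarrow> 'b" where
  "scaleR_fun c f = (\<lambda>x. c *\<^sub>R f x)"

instance
  by standard (auto simp: scaleR_fun_def fun_eq_iff algebra_simps)

end

definition is_norm_on :: "'a::real_vector set \<Rightarrow> ('a \<Rightarrow> real) \<Rightarrow> bool" where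
  "is_norm_on V N \<longleftrightarrow>
     (\<forall>u\<in>V. 0 \<le> N u) \<and>
     (\<forall>u\<in>V. N u = 0 \<longleftrightarrow> u = 0) \<and>
     (\<forall>u\<in>V. \<forall>c. N (c *\<^sub>R u) = \<bar>c\<bar> * N u) \<and>
     (\<forall>u\<in>V. \<forall>v\<in>V. N (u + v) \<le> N u + N v)"

definition positive_cone :: "'a::real_vector set \<Rightarrow> bool" where
  "positive_cone K \<longleftrightarrow>
     K \<inter> uminus ` K = {0} \<and>
     (\<forall>x\<in>K. \<forall>y\<in>K. x + y \<in> K) \<and>
     (\<forall>c\<ge>0. \<forall>x\<in>K. c *\<^sub>R x \<in> K)"

definition cone_le :: "'a::real_vector set \<Rightarrow> 'a \<Rightarrow> 'a \<Rightarrow> bool" where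
  "cone_le K x y \<longleftrightarrow> y - x \<in> K"

section \<open>Control systems\<close>

text \<open>
  The state space is the whole type \<open>'x\<close>. An input, a function on \<open>[0, \<infinity>)\<close>, is represented by
  the function on \<^typ>\<open>real\<close> that extends it by \<open>0\<close> to negative times; this is a linear bijection
  between functions on \<open>[0, \<infinity>)\<close> and functions on \<^typ>\<open>real\<close> vanishing at negative times.
\<close>

definition shift_input :: "real \<Rightarrow> (real \<Rightarrow> 'v::zero) \<Rightarrow> real \<Rightarrow> 'v" where
  "shift_input \<tau> u = (\<lambda>s. if s < 0 then 0 else u (s + \<tau>))"

record ('x, 'v) control_system =
  input_values :: "'v set"
  inputs :: "(real \<Rightarrow> 'v) set"
  input_norm :: "(real \<Rightarrow> 'v) \<Rightarrow> real"
  admissible :: "'x \<Rightarrow> (real \<Rightarrow> 'v) set"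
  flow :: "real \<Rightarrow> 'x \<Rightarrow> (real \<Rightarrow> 'v) \<Rightarrow> 'x"

text \<open>
  Only the values of \<^const>\<open>flow\<close> at times \<open>t \<ge> 0\<close> and admissible inputs matter. That these values
  are defined for all \<open>t \<ge> 0\<close> is expressed by totality of the function.
\<close>

locale control_system =
  fixes S :: "('x::real_normed_vector, 'v::real_normed_vector, 'm) control_system_scheme"
  assumes input_values_nonempty: "input_values S \<noteq> {}"
    and input_range: "u \<in> inputs S \<Longrightarrow> 0 \<le> t \<Longrightarrow> u t \<in> input_values S"
    and input_negative: "u \<in> inputs S \<Longrightarrow> t < 0 \<Longrightarrow> u t = 0"
    and inputs_subspace: "subspace (inputs S)"
    and input_norm: "is_norm_on (inputs S) (input_norm S)"
    and inputs_shift: "u \<in> inputs S \<Longrightarrow> 0 \<le> \<tau> \<Longrightarrow> shift_input \<tau> u \<in> inputs S"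
    and admissible_inputs: "admissible S x \<subseteq> inputs S"
    and admissible_nonempty: "admissible S x \<noteq> {}"
    and flow_zero: "u \<in> admissible S x \<Longrightarrow> flow S 0 x u = x"
    and flow_causal:
      "0 \<le> t \<Longrightarrow> u \<in> admissible S x \<Longrightarrow> v \<in> admissible S x \<Longrightarrow> (\<And>s. s \<in> {0..t} \<Longrightarrow> u s = v s)
        \<Longrightarrow> flow S t x u = flow S t x v"
    and admissible_shift:
      "0 \<le> t \<Longrightarrow> u \<in> admissible S x \<Longrightarrow> shift_input t u \<in> admissible S (flow S t x u)"
    and flow_cocycle:
      "0 \<le> t \<Longrightarrow> 0 \<le> h \<Longrightarrow> u \<in> admissible S x
        \<Longrightarrow> flow S h (flow S t x u) (shift_input t u) = flow S (t + h) x u"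

record ('x, 'v) ordered_control_system = "('x, 'v) control_system" +
  state_cone :: "'x set"
  input_cone :: "(real \<Rightarrow> 'v) set"

locale ordered_control_system = control_system S
  for S :: "('x::real_normed_vector, 'v::real_normed_vector, 'm) ordered_control_system_scheme" +
  assumes state_cone: "positive_cone (state_cone S)"
    and input_cone_inputs: "input_cone S \<subseteq> inputs S"
    and input_cone: "positive_cone (input_cone S)"

abbreviation state_le where
  "state_le S \<equiv> cone_le (state_cone S)"

abbreviation input_le where
  "input_le S \<equiv> cone_le (input_cone S)"

locale monotone_control_system = ordered_control_system +
  assumes flow_mono:
    "0 \<le> t \<Longrightarrow> state_le S x1 x2 \<Longrightarrow> u1 \<in> admissible S x1 \<Longrightarrow> u2 \<in> admissible S x2
      \<Longrightarrow> input_le S u1 u2 \<Longrightarrow> state_le S (flow S t x1 u1) (flow S t x2 u2)"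

section \<open>Stability\<close>

definition ISS_wrt ::
  "('x::real_normed_vector, 'v, 'm) control_system_scheme \<Rightarrow> (real \<Rightarrow> 'v) set \<Rightarrow> bool" where
  "ISS_wrt S Uc \<longleftrightarrow>
     (\<exists>\<beta>\<in>class_KL. \<exists>\<gamma>\<in>class_K. \<forall>x. \<forall>u \<in> admissible S x \<inter> Uc. \<forall>t\<ge>0.
        norm (flow S t x u) \<le> \<beta> (norm x) t + \<gamma> (input_norm S u))"

definition exp_ISS_wrt ::
  "('x::real_normed_vector, 'v, 'm) control_system_scheme \<Rightarrow> (real \<Rightarrow> 'v) set \<Rightarrow> bool" where
  "exp_ISS_wrt S Uc \<longleftrightarrow>
     (\<exists>M>0. \<exists>\<omega>>0. \<exists>\<gamma>\<in>class_Kinf. \<forall>x. \<forall>u \<in> admissible S x \<inter> Uc. \<forall>t\<ge>0.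
        norm (flow S t x u) \<le> M * exp (- \<omega> * t) * norm x + \<gamma> (input_norm S u))"

definition exp_ISS_linear_gain_wrt ::
  "('x::real_normed_vector, 'v, 'm) control_system_scheme \<Rightarrow> (real \<Rightarrow> 'v) set \<Rightarrow> bool" where
  "exp_ISS_linear_gain_wrt S Uc \<longleftrightarrow>
     (\<exists>M>0. \<exists>\<omega>>0. \<exists>\<gamma>\<in>class_Kinf. linear_on_nonneg \<gamma> \<and>
        (\<forall>x. \<forall>u \<in> admissible S x \<inter> Uc. \<forall>t\<ge>0.
           norm (flow S t x u) \<le> M * exp (- \<omega> * t) * norm x + \<gamma> (input_norm S u)))"

definition ISS :: "('x::real_normed_vector, 'v, 'm) control_system_scheme \<Rightarrow> bool" where
  "ISS S \<longleftrightarrow> ISS_wrt S (inputs S)"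

definition exp_ISS :: "('x::real_normed_vector, 'v, 'm) control_system_scheme \<Rightarrow> bool" where
  "exp_ISS S \<longleftrightarrow> exp_ISS_wrt S (inputs S)"

definition exp_ISS_linear_gain ::
  "('x::real_normed_vector, 'v, 'm) control_system_scheme \<Rightarrow> bool" where
  "exp_ISS_linear_gain S \<longleftrightarrow> exp_ISS_linear_gain_wrt S (inputs S)"

end

theory Submission
  imports Defs
begin

text \<open>
  Fix \<open>x\<close>, an admissible \<open>u\<close> and \<open>\<epsilon> > 0\<close>. Hypothesis (ii) traps \<open>x\<close> and \<open>u\<close> between data
  \<open>x\<^sub>-, x\<^sub>+, u\<^sub>-, u\<^sub>+\<close> with inputs in \<open>U\<^sub>c\<close>; by monotonicity the trajectory from \<open>x\<close> stays between the
  two outer trajectories, for which an ISS estimate \<open>\<beta>, \<gamma>\<close> is known, and hypothesis (i) turns the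
  order bounds into a norm bound. With \<open>a = \<parallel>x\<parallel>\<close> and \<open>b = \<parallel>u\<parallel>\<close> the result is
  \<open>\<parallel>\<phi>(t,x,u)\<parallel> \<le> \<rho> (2 \<beta>(\<xi>(a + b + \<epsilon>), t) + 2 \<gamma>(\<eta>(b + \<epsilon>)))\<close>. Since the left side does not depend
  on \<open>\<epsilon>\<close>, continuity of the comparison functions allows \<open>\<epsilon> = 0\<close>.

  It remains to separate \<open>a\<close> from \<open>b\<close>. The inequality \<open>f (p + q) \<le> f (2 p) + f (2 q)\<close>, valid for
  every increasing nonnegative \<open>f\<close>, is used once for \<open>\<rho>\<close> and once for \<open>s \<mapsto> \<rho> (4 \<beta>(\<xi> s, t))\<close>; the
  term in \<open>b\<close> from the second use is bounded by its value at \<open>t = 0\<close>. This gives an estimate for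
  all inputs with \<open>\<beta>'(r, t) = \<rho> (4 \<beta>(\<xi>(2 r), t))\<close> and
  \<open>\<gamma>'(b) = \<rho> (4 \<beta>(\<xi>(2 b), 0)) + \<rho> (4 \<gamma>(\<eta> b))\<close>, which is lemma \<open>sandwich_estimate\<close>.

  The exponential statements use the same estimate. The function \<open>M exp (- \<omega> t) r\<close> is of class
  \<open>KL\<close>, and if \<open>\<rho>\<close> and \<open>\<xi>\<close> are linear, then \<open>\<beta>'\<close> has this form again, with the same rate
  \<open>\<omega>\<close>. If moreover \<open>\<gamma>\<close> and \<open>\<eta>\<close> are linear, so is \<open>\<gamma>'\<close>. The converse directions hold because
  restricting the inputs weakens the condition.
\<close>

section \<open>Closure properties of comparison functions\<close>

lemma class_K_I:
  assumes "continuous_on {0..} \<gamma>" "strict_mono_on {0..} \<gamma>" "\<gamma> 0 = 0"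
  shows "\<gamma> \<in> class_K"
proof -
  have "0 \<le> \<gamma> r" if "0 \<le> r" for r
    using strict_mono_on_leD[OF assms(2), of 0 r] that assms(3) by simp
  then show ?thesis using assms by (auto simp: class_K_def)
qed

lemma class_K_D:
  assumes "\<gamma> \<in> class_K"
  shows "continuous_on {0..} \<gamma>" "strict_mono_on {0..} \<gamma>" "\<gamma> 0 = 0" "\<And>r. 0 \<le> r \<Longrightarrow> 0 \<le> \<gamma> r"
  using assms by (auto simp: class_K_def)

lemma class_K_mono: "\<gamma> \<in> class_K \<Longrightarrow> 0 \<le> r \<Longrightarrow> r \<le> s \<Longrightarrow> \<gamma> r \<le> \<gamma> s"
  using strict_mono_on_leD[OF class_K_D(2), of \<gamma> r s] by simp

lemma class_K_less: "\<gamma> \<in> class_K \<Longrightarrow> 0 \<le> r \<Longrightarrow> r < s \<Longrightarrow> \<gamma> r < \<gamma> s"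
  using strict_mono_onD[OF class_K_D(2), of \<gamma> r s] by simp

lemma class_K_continuous_comp:
  assumes "\<gamma> \<in> class_K" "continuous_on A f" "\<And>x. x \<in> A \<Longrightarrow> 0 \<le> f x"
  shows "continuous_on A (\<lambda>x. \<gamma> (f x))"
  by (rule continuous_on_compose2[OF class_K_D(1)[OF assms(1)] assms(2)]) (use assms(3) in auto)

lemma class_K_comp:
  assumes "f \<in> class_K" "g \<in> class_K"
  shows "(\<lambda>r. f (g r)) \<in> class_K"
proof (rule class_K_I)
  show "continuous_on {0..} (\<lambda>r. f (g r))"
    using class_K_continuous_comp[OF assms(1) class_K_D(1)[OF assms(2)]] class_K_D(4)[OF assms(2)]
    by simp
  show "strict_mono_on {0..} (\<lambda>r. f (g r))"
    using class_K_D(4)[OF assms(2)]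
    by (auto intro!: strict_mono_onI class_K_less[OF assms(1)] class_K_less[OF assms(2)])
qed (simp add: class_K_D(3)[OF assms(1)] class_K_D(3)[OF assms(2)])

lemma class_K_add:
  assumes "f \<in> class_K" "g \<in> class_K"
  shows "(\<lambda>r. f r + g r) \<in> class_K"
proof (rule class_K_I)
  show "continuous_on {0..} (\<lambda>r. f r + g r)"
    by (intro continuous_on_add class_K_D(1)[OF assms(1)] class_K_D(1)[OF assms(2)])
  show "strict_mono_on {0..} (\<lambda>r. f r + g r)"
    by (auto intro!: strict_mono_onI add_strict_mono class_K_less[OF assms(1)]
        class_K_less[OF assms(2)])
qed (simp add: class_K_D(3)[OF assms(1)] class_K_D(3)[OF assms(2)])

lemma class_K_mult: "0 < c \<Longrightarrow> (\<lambda>r. c * r) \<in> class_K"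
  by (rule class_K_I) (auto intro!: strict_mono_onI continuous_intros)

lemma class_K_add_le:
  assumes "f \<in> class_K" "0 \<le> p" "0 \<le> q"
  shows "f (p + q) \<le> f (2 * p) + f (2 * q)"
proof -
  have "f (p + q) \<le> f (2 * max p q)"
    by (rule class_K_mono[OF assms(1)]) (use assms in auto)
  also have "\<dots> \<le> f (2 * p) + f (2 * q)"
    using class_K_D(4)[OF assms(1), of "2 * p"] class_K_D(4)[OF assms(1), of "2 * q"] assms
    by (auto simp: max_def)
  finally show ?thesis .
qed

lemma class_Kinf_iff:
  "\<gamma> \<in> class_Kinf \<longleftrightarrow> \<gamma> \<in> class_K \<and> (\<forall>B. \<exists>r\<ge>0. B < \<gamma> r)"
proof -
  have "bounded (\<gamma> ` {0..}) \<longleftrightarrow> (\<exists>B. \<forall>r\<ge>0. \<gamma> r \<le> B)" if "\<gamma> \<in> class_K"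
  proof -
    have "\<bar>\<gamma> r\<bar> = \<gamma> r" if "0 \<le> r" for r using class_K_D(4)[OF \<open>\<gamma> \<in> class_K\<close> that] by simp
    then show ?thesis unfolding bounded_iff by auto
  qed
  then show ?thesis by (simp add: class_Kinf_def flip: not_less) blast
qed

lemma class_Kinf_imp_K: "\<gamma> \<in> class_Kinf \<Longrightarrow> \<gamma> \<in> class_K"
  by (simp add: class_Kinf_def)

lemma class_Kinf_comp:
  assumes "f \<in> class_Kinf" "g \<in> class_Kinf"
  shows "(\<lambda>r. f (g r)) \<in> class_Kinf"
  unfolding class_Kinf_iff
proof (intro conjI allI)
  show "(\<lambda>r. f (g r)) \<in> class_K"
    using assms by (simp add: class_K_comp class_Kinf_imp_K)
  fix B
  obtain s where s: "0 \<le> s" "B < f s" using assms(1) by (auto simp: class_Kinf_iff)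
  obtain r where r: "0 \<le> r" "s < g r" using assms(2) by (auto simp: class_Kinf_iff)
  have "f s < f (g r)" by (rule class_K_less[OF class_Kinf_imp_K[OF assms(1)] s(1) r(2)])
  then show "\<exists>r\<ge>0. B < f (g r)" using s r by (meson less_trans)
qed

lemma class_Kinf_mult: "0 < c \<Longrightarrow> (\<lambda>r. c * r) \<in> class_Kinf"
  unfolding class_Kinf_iff
proof (intro conjI allI)
  fix B :: real
  assume c: "0 < c"
  then have "B < c * ((\<bar>B\<bar> + 1) / c)" by simp
  then show "\<exists>r\<ge>0. B < c * r" using c
    by (intro exI[of _ "(\<bar>B\<bar> + 1) / c"]) auto
qed (rule class_K_mult)

lemma class_Kinf_add:
  assumes "f \<in> class_K" "g \<in> class_Kinf"
  shows "(\<lambda>r. f r + g r) \<in> class_Kinf"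
  unfolding class_Kinf_iff
proof (intro conjI allI)
  show "(\<lambda>r. f r + g r) \<in> class_K"
    using assms by (simp add: class_K_add class_Kinf_imp_K)
  fix B
  obtain r where "0 \<le> r" "B < g r" using assms(2) by (auto simp: class_Kinf_iff)
  with class_K_D(4)[OF assms(1), of r] show "\<exists>r\<ge>0. B < f r + g r" by (intro exI[of _ r]) auto
qed

lemma class_KL_antimono:
  assumes "\<beta> \<in> class_KL" "0 \<le> r" "0 \<le> t"
  shows "\<beta> r t \<le> \<beta> r 0"
proof (cases "r = 0 \<or> t = 0")
  case True
  then show ?thesis using assms by (auto simp: class_KL_def class_K_def)
next
  case False
  then have "\<beta> r \<in> class_L" using assms by (simp add: class_KL_def)
  then have "strict_antimono_on {0..} (\<beta> r)" by (simp add: class_L_def)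
  then show ?thesis using False assms by (force dest: monotone_onD[where x = 0 and y = t])
qed

lemma class_KL_comp:
  assumes f: "f \<in> class_K" and \<beta>: "\<beta> \<in> class_KL" and g: "g \<in> class_K"
  shows "(\<lambda>r t. f (\<beta> (g r) t)) \<in> class_KL"
  unfolding class_KL_def
proof (intro CollectI conjI allI impI)
  have \<beta>cont: "continuous_on ({0..} \<times> {0..}) (\<lambda>(r, t). \<beta> r t)"
    and \<beta>nonneg: "\<And>r t. 0 \<le> r \<Longrightarrow> 0 \<le> t \<Longrightarrow> 0 \<le> \<beta> r t"
    and \<beta>K: "\<And>t. 0 \<le> t \<Longrightarrow> (\<lambda>r. \<beta> r t) \<in> class_K"
    and \<beta>L: "\<And>r. 0 < r \<Longrightarrow> \<beta> r \<in> class_L"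
    using \<beta> by (auto simp: class_KL_def)
  have "continuous_on ({0..} \<times> {0..}) (\<lambda>p::real \<times> real. (g (fst p), snd p))"
    by (intro continuous_on_Pair class_K_continuous_comp[OF g] continuous_intros) auto
  then have "continuous_on ({0..} \<times> {0..})
      (\<lambda>p. (\<lambda>(r, t). \<beta> r t) (g (fst p), snd p))"
    by (rule continuous_on_compose2[OF \<beta>cont]) (auto intro: class_K_D(4)[OF g])
  then have "continuous_on ({0..} \<times> {0..}) (\<lambda>p. f (\<beta> (g (fst p)) (snd p)))"
    unfolding prod.case
    by (rule class_K_continuous_comp[OF f]) (auto intro!: \<beta>nonneg class_K_D(4)[OF g])
  then show "continuous_on ({0..} \<times> {0..}) (\<lambda>(r, t). f (\<beta> (g r) t))"
    by (simp add: case_prod_beta)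
  show "0 \<le> f (\<beta> (g r) t)" if "0 \<le> r" "0 \<le> t" for r t
    using that by (intro class_K_D(4)[OF f] \<beta>nonneg class_K_D(4)[OF g])
  show "(\<lambda>r. f (\<beta> (g r) t)) \<in> class_K" if "0 \<le> t" for t
    using class_K_comp[OF f class_K_comp[OF \<beta>K[OF that] g]] .
  show "(\<lambda>t. f (\<beta> (g r) t)) \<in> class_L" if "0 < r" for r
  proof -
    have gr: "0 < g r" using class_K_less[OF g, of 0 r] that class_K_D(3)[OF g] by simp
    note L = \<beta>L[OF gr, unfolded class_L_def, simplified]
    have "((\<lambda>t. f (\<beta> (g r) t)) \<longlongrightarrow> f 0) at_top"
    proof (rule continuous_on_tendsto_compose[OF class_K_D(1)[OF f]])
      show "\<forall>\<^sub>F t in at_top. \<beta> (g r) t \<in> {0..}"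
        using eventually_ge_at_top[of 0] by eventually_elim (use gr \<beta>nonneg in simp)
    qed (use L in auto)
    moreover have "strict_antimono_on {0..} (\<lambda>t. f (\<beta> (g r) t))"
      using L gr by (auto intro!: monotone_onI class_K_less[OF f] \<beta>nonneg simp: monotone_on_def)
    moreover have "continuous_on {0..} (\<lambda>t. f (\<beta> (g r) t))"
      using L gr by (intro class_K_continuous_comp[OF f]) (auto intro: \<beta>nonneg)
    ultimately show ?thesis
      using gr class_K_D(3,4)[OF f] \<beta>nonneg by (auto simp: class_L_def)
  qed
qed

lemma class_KL_exp:
  assumes "0 < M" "0 < \<omega>"
  shows "(\<lambda>r t. M * exp (- \<omega> * t) * r) \<in> class_KL"
  unfolding class_KL_def
proof (intro CollectI conjI allI impI)
  show "continuous_on ({0..} \<times> {0..}) (\<lambda>(r, t). M * exp (- \<omega> * t) * r)"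
    unfolding case_prod_beta by (intro continuous_intros)
  show "0 \<le> M * exp (- \<omega> * t) * r" if "0 \<le> r" for r t
    using that assms by simp
  show "(\<lambda>r. M * exp (- \<omega> * t) * r) \<in> class_K" for t
    using assms by (intro class_K_mult) simp
  show "(\<lambda>t. M * exp (- \<omega> * t) * r) \<in> class_L" if "0 < r" for r
  proof -
    have "((\<lambda>t. M * exp (- \<omega> * t) * r) \<longlongrightarrow> M * 0 * r) at_top"
      using assms
      by (intro tendsto_intros filterlim_compose[OF exp_at_bot]
          filterlim_tendsto_neg_mult_at_bot[OF tendsto_const] filterlim_ident) auto
    moreover have "continuous_on {0..} (\<lambda>t. M * exp (- \<omega> * t) * r)"
      by (intro continuous_intros)
    ultimately show ?thesis
      using assms that by (auto simp: class_L_def intro!: monotone_onI)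
  qed
qed

lemma class_K_linear_pos:
  assumes "\<gamma> \<in> class_K" "linear_on_nonneg \<gamma>"
  shows "\<exists>c>0. \<forall>r\<ge>0. \<gamma> r = c * r"
proof -
  obtain c where c: "\<forall>r\<ge>0. \<gamma> r = c * r" using assms(2) by (auto simp: linear_on_nonneg_def)
  have "0 < c" using class_K_less[OF assms(1), of 0 1] c by simp
  with c show ?thesis by blast
qed

section \<open>The estimate for arbitrary inputs\<close>

text \<open>
  The decay in \<open>t\<close> survives only in the term with \<open>norm x\<close>: the trapping states depend on \<open>u\<close> as
  well, so their transient contributes to the gain, with the value of \<open>\<beta>\<close> at time \<open>0\<close>.
\<close>

lemma sandwich_estimate:
  fixes S :: "('x::real_normed_vector, 'v::real_normed_vector, 'm) ordered_control_system_scheme"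
  assumes mono: "monotone_control_system S"
    and \<rho>: "\<rho> \<in> class_K"
    and norm_between: "\<And>xm x xp. state_le S xm x \<Longrightarrow> state_le S x xp \<Longrightarrow>
      norm x \<le> \<rho> (norm xm + norm xp)"
    and \<eta>: "\<eta> \<in> class_K"
    and \<xi>: "\<xi> \<in> class_K"
    and sandwich: "\<And>x u \<epsilon>. u \<in> admissible S x \<Longrightarrow> 0 < \<epsilon> \<Longrightarrow>
      \<exists>xm xp. \<exists>um \<in> admissible S xm \<inter> Uc. \<exists>up \<in> admissible S xp \<inter> Uc.
        state_le S xm x \<and> state_le S x xp \<and> input_le S um u \<and> input_le S u up \<and>
        max (input_norm S um) (input_norm S up) \<le> \<eta> (input_norm S u + \<epsilon>) \<and>
        max (norm xm) (norm xp) \<le> \<xi> (norm x + input_norm S u + \<epsilon>)"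
    and \<beta>: "\<beta> \<in> class_KL"
    and \<gamma>: "\<gamma> \<in> class_K"
    and bound: "\<And>x u t. u \<in> admissible S x \<inter> Uc \<Longrightarrow> 0 \<le> t \<Longrightarrow>
      norm (flow S t x u) \<le> \<beta> (norm x) t + \<gamma> (input_norm S u)"
    and u: "u \<in> admissible S x"
    and t: "0 \<le> t"
  shows "norm (flow S t x u) \<le> \<rho> (4 * \<beta> (\<xi> (2 * norm x)) t) +
    (\<rho> (4 * \<beta> (\<xi> (2 * input_norm S u)) 0) + \<rho> (4 * \<gamma> (\<eta> (input_norm S u))))"
proof -
  interpret monotone_control_system S by fact
  have input_norm_nonneg: "0 \<le> input_norm S v" if "v \<in> admissible S y" for v y
    using that admissible_inputs input_norm by (auto simp: is_norm_on_def)
  define a where "a = norm x"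
  define b where "b = input_norm S u"
  have a: "0 \<le> a" and b: "0 \<le> b" using u by (auto simp: a_def b_def input_norm_nonneg)
  have \<beta>t: "(\<lambda>r. \<beta> r t) \<in> class_K" using \<beta> t by (simp add: class_KL_def)
  define F where "F = (\<lambda>\<epsilon>. \<rho> (2 * \<beta> (\<xi> (a + b + \<epsilon>)) t + 2 * \<gamma> (\<eta> (b + \<epsilon>))))"
  have F_bound: "norm (flow S t x u) \<le> F \<epsilon>" if \<epsilon>: "0 < \<epsilon>" for \<epsilon>
  proof -
    obtain xm xp um up where
      um: "um \<in> admissible S xm \<inter> Uc" and up: "up \<in> admissible S xp \<inter> Uc"
      and le: "state_le S xm x" "state_le S x xp" "input_le S um u" "input_le S u up"
      and unorm: "max (input_norm S um) (input_norm S up) \<le> \<eta> (b + \<epsilon>)"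
      and xnorm: "max (norm xm) (norm xp) \<le> \<xi> (a + b + \<epsilon>)"
      using sandwich[OF u \<epsilon>] unfolding a_def b_def by blast
    have outer: "norm (flow S t y v) \<le> \<beta> (\<xi> (a + b + \<epsilon>)) t + \<gamma> (\<eta> (b + \<epsilon>))"
      if "v \<in> admissible S y \<inter> Uc" "input_norm S v \<le> \<eta> (b + \<epsilon>)" "norm y \<le> \<xi> (a + b + \<epsilon>)" for y v
    proof -
      have "norm (flow S t y v) \<le> \<beta> (norm y) t + \<gamma> (input_norm S v)"
        by (rule bound[OF that(1) t])
      also have "\<dots> \<le> \<beta> (\<xi> (a + b + \<epsilon>)) t + \<gamma> (\<eta> (b + \<epsilon>))"
        using that input_norm_nonneg
        by (intro add_mono class_K_mono[OF \<beta>t] class_K_mono[OF \<gamma>]) auto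
      finally show ?thesis .
    qed
    have "norm (flow S t x u) \<le> \<rho> (norm (flow S t xm um) + norm (flow S t xp up))"
      using flow_mono t le um up u by (intro norm_between) auto
    also have "\<dots> \<le> F \<epsilon>"
      unfolding F_def using outer[OF um] outer[OF up] unorm xnorm
      by (intro class_K_mono[OF \<rho>]) auto
    finally show ?thesis .
  qed
  have \<beta>_nonneg: "0 \<le> \<beta> r s" if "0 \<le> r" "0 \<le> s" for r s
    using \<beta> that by (simp add: class_KL_def)
  have "continuous_on {0..} F"
    unfolding F_def using a b t
    by (intro class_K_continuous_comp[OF \<rho>] class_K_continuous_comp[OF \<gamma>]
        class_K_continuous_comp[OF \<eta>] class_K_continuous_comp[OF \<xi>]
        class_K_continuous_comp[OF \<beta>t] continuous_intros)
      (auto intro!: add_nonneg_nonneg mult_nonneg_nonneg \<beta>_nonneg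
        class_K_D(4)[OF \<xi>] class_K_D(4)[OF \<eta>] class_K_D(4)[OF \<gamma>])
  then have "(F \<longlongrightarrow> F 0) (at_right 0)"
    by (auto simp: continuous_on_def intro: tendsto_within_subset)
  then have "norm (flow S t x u) \<le> F 0"
    by (rule tendsto_lowerbound)
      (auto intro!: F_bound eventually_at_right_less[THEN eventually_mono])
  also have "F 0 \<le> \<rho> (4 * \<beta> (\<xi> (a + b)) t) + \<rho> (4 * \<gamma> (\<eta> b))"
    using class_K_add_le[OF \<rho>, of "2 * \<beta> (\<xi> (a + b)) t" "2 * \<gamma> (\<eta> b)"] a b t
    by (simp add: F_def \<beta>_nonneg class_K_D(4)[OF \<xi>] class_K_D(4)[OF \<eta>] class_K_D(4)[OF \<gamma>])
  also have "\<rho> (4 * \<beta> (\<xi> (a + b)) t) \<le>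
      \<rho> (4 * \<beta> (\<xi> (2 * a)) t) + \<rho> (4 * \<beta> (\<xi> (2 * b)) t)"
    using class_K_add_le[OF class_K_comp[OF \<rho> class_K_comp[OF class_K_mult[of 4]
            class_K_comp[OF \<beta>t \<xi>]]] a b] by simp
  also have "\<rho> (4 * \<beta> (\<xi> (2 * b)) t) \<le> \<rho> (4 * \<beta> (\<xi> (2 * b)) 0)"
    using b t class_K_D(4)[OF \<xi>, of "2 * b"]
    by (intro class_K_mono[OF \<rho>]) (auto intro: class_KL_antimono[OF \<beta>] \<beta>_nonneg)
  finally show ?thesis by (simp add: a_def b_def add.assoc)
qed

section \<open>Equivalence of the stability notions\<close>

lemma ISS_wrt_antimono: "ISS_wrt S U \<Longrightarrow> V \<subseteq> U \<Longrightarrow> ISS_wrt S V"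
  unfolding ISS_wrt_def by blast

lemma exp_ISS_wrt_antimono: "exp_ISS_wrt S U \<Longrightarrow> V \<subseteq> U \<Longrightarrow> exp_ISS_wrt S V"
  unfolding exp_ISS_wrt_def by blast

theorem mainTheorem2:
  fixes S :: "('x::real_normed_vector, 'v::real_normed_vector) ordered_control_system"
    and Uc :: "(real \<Rightarrow> 'v) set"
    and \<rho> \<eta> \<xi> :: "real \<Rightarrow> real"
  assumes "monotone_control_system S"
    and "Uc \<subseteq> inputs S"
    and "\<rho> \<in> class_Kinf"
    and "\<And>xm x xp. state_le S xm x \<Longrightarrow> state_le S x xp \<Longrightarrow> norm x \<le> \<rho> (norm xm + norm xp)"
    and "\<eta> \<in> class_Kinf"
    and "\<xi> \<in> class_Kinf"
    and "\<And>x u \<epsilon>. u \<in> admissible S x \<Longrightarrow> 0 < \<epsilon> \<Longrightarrow>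
      \<exists>xm xp. \<exists>um \<in> admissible S xm \<inter> Uc. \<exists>up \<in> admissible S xp \<inter> Uc.
        state_le S xm x \<and> state_le S x xp \<and> input_le S um u \<and> input_le S u up \<and>
        max (input_norm S um) (input_norm S up) \<le> \<eta> (input_norm S u + \<epsilon>) \<and>
        max (norm xm) (norm xp) \<le> \<xi> (norm x + input_norm S u + \<epsilon>)"
  shows "(ISS S \<longleftrightarrow> ISS_wrt S Uc) \<and>
    (linear_on_nonneg \<rho> \<and> linear_on_nonneg \<xi> \<longrightarrow>
      (exp_ISS S \<longleftrightarrow> exp_ISS_wrt S Uc) \<and>
      (exp_ISS_linear_gain_wrt S Uc \<and> linear_on_nonneg \<eta> \<longrightarrow> exp_ISS_linear_gain S))"
proof -
  note K = assms(3,5,6)[THEN class_Kinf_imp_K]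
  have estimate: "norm (flow S t x u) \<le> \<rho> (4 * \<beta> (\<xi> (2 * norm x)) t) +
      (\<rho> (4 * \<beta> (\<xi> (2 * input_norm S u)) 0) + \<rho> (4 * \<gamma> (\<eta> (input_norm S u))))"
    if "\<beta> \<in> class_KL" "\<gamma> \<in> class_K"
      and "\<And>x u t. u \<in> admissible S x \<inter> Uc \<Longrightarrow> 0 \<le> t \<Longrightarrow>
        norm (flow S t x u) \<le> \<beta> (norm x) t + \<gamma> (input_norm S u)"
      and "u \<in> admissible S x" "0 \<le> t" for \<beta> \<gamma> x u t
    by (rule sandwich_estimate[where Uc = Uc]) (fact assms K that)+
  have \<rho>4: "(\<lambda>s. \<rho> (4 * s)) \<in> class_K" and \<xi>2: "(\<lambda>r. \<xi> (2 * r)) \<in> class_K"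
    using class_K_comp[OF K(1) class_K_mult[of 4]] class_K_comp[OF K(3) class_K_mult[of 2]]
    by simp_all

  define gain where
    "gain \<beta> \<gamma> = (\<lambda>r. \<rho> (4 * \<beta> (\<xi> (2 * r)) 0) + \<rho> (4 * \<gamma> (\<eta> r)))"
    for \<beta> :: "real \<Rightarrow> real \<Rightarrow> real" and \<gamma>
  have transient_K: "(\<lambda>r. \<rho> (4 * \<beta> (\<xi> (2 * r)) 0)) \<in> class_K" if "\<beta> \<in> class_KL" for \<beta>
    using class_KL_comp[OF \<rho>4 that \<xi>2] by (simp add: class_KL_def)

  have ISS: "ISS S" if "ISS_wrt S Uc"
  proof -
    from that obtain \<beta> \<gamma> where \<beta>: "\<beta> \<in> class_KL" and \<gamma>: "\<gamma> \<in> class_K"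
      and bound: "\<And>x u t. u \<in> admissible S x \<inter> Uc \<Longrightarrow> 0 \<le> t \<Longrightarrow>
        norm (flow S t x u) \<le> \<beta> (norm x) t + \<gamma> (input_norm S u)"
      unfolding ISS_wrt_def by metis
    have gain: "gain \<beta> \<gamma> \<in> class_K"
      unfolding gain_def
      by (rule class_K_add[OF transient_K[OF \<beta>] class_K_comp[OF \<rho>4 class_K_comp[OF \<gamma> K(2)]]])
    have KL: "(\<lambda>r t. \<rho> (4 * \<beta> (\<xi> (2 * r)) t)) \<in> class_KL"
      by (rule class_KL_comp[OF \<rho>4 \<beta> \<xi>2])
    have "norm (flow S t x u) \<le>
        \<rho> (4 * \<beta> (\<xi> (2 * norm x)) t) + gain \<beta> \<gamma> (input_norm S u)"
      if "u \<in> admissible S x" "0 \<le> t" for x u t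
      unfolding gain_def by (rule estimate[OF \<beta> \<gamma> bound that])
    then show ?thesis
      unfolding ISS_def ISS_wrt_def by (intro bexI[OF _ KL] bexI[OF _ gain]) blast
  qed

  \<comment> \<open>The claim about linear gains depends on which gain occurs, so the bound names it; only the
    factor \<open>M'\<close> is existential.\<close>
  have exp_bound: "gain (\<lambda>r t. M * exp (- \<omega> * t) * r) \<gamma> \<in> class_Kinf \<and>
      (\<exists>M'>0. \<forall>x. \<forall>u \<in> admissible S x. \<forall>t\<ge>0. norm (flow S t x u) \<le>
        M' * exp (- \<omega> * t) * norm x +
        gain (\<lambda>r t. M * exp (- \<omega> * t) * r) \<gamma> (input_norm S u))"
    if lin: "linear_on_nonneg \<rho>" "linear_on_nonneg \<xi>" and M: "0 < M" and \<omega>: "0 < \<omega>"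
      and \<gamma>: "\<gamma> \<in> class_Kinf"
      and bound: "\<And>x u t. u \<in> admissible S x \<inter> Uc \<Longrightarrow> 0 \<le> t \<Longrightarrow>
        norm (flow S t x u) \<le> M * exp (- \<omega> * t) * norm x + \<gamma> (input_norm S u)"
    for M \<omega> \<gamma>
  proof
    obtain c where c: "0 < c" "\<And>r. 0 \<le> r \<Longrightarrow> \<rho> r = c * r"
      using class_K_linear_pos[OF K(1) lin(1)] by blast
    obtain d where d: "0 < d" "\<And>r. 0 \<le> r \<Longrightarrow> \<xi> r = d * r"
      using class_K_linear_pos[OF K(3) lin(2)] by blast
    note \<beta> = class_KL_exp[OF M \<omega>]
    have "(\<lambda>r. \<rho> (4 * \<gamma> (\<eta> r))) \<in> class_Kinf"
      using class_Kinf_comp[OF assms(3) class_Kinf_comp[OF class_Kinf_mult[of 4]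
            class_Kinf_comp[OF \<gamma> assms(5)]]] by simp
    then show "gain (\<lambda>r t. M * exp (- \<omega> * t) * r) \<gamma> \<in> class_Kinf"
      unfolding gain_def by (rule class_Kinf_add[OF transient_K[OF \<beta>]])
    have "norm (flow S t x u) \<le> (8 * c * d * M) * exp (- \<omega> * t) * norm x +
        gain (\<lambda>r t. M * exp (- \<omega> * t) * r) \<gamma> (input_norm S u)"
      if "u \<in> admissible S x" "0 \<le> t" for x u t
    proof -
      have "\<rho> (4 * (M * exp (- \<omega> * t) * \<xi> (2 * norm x))) =
          (8 * c * d * M) * exp (- \<omega> * t) * norm x"
        using c d M by simp
      then show ?thesis
        using estimate[OF \<beta> class_Kinf_imp_K[OF \<gamma>] bound that] unfolding gain_def by simp
    qed
    then show "\<exists>M'>0. \<forall>x. \<forall>u \<in> admissible S x. \<forall>t\<ge>0. norm (flow S t x u) \<le>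
        M' * exp (- \<omega> * t) * norm x +
        gain (\<lambda>r t. M * exp (- \<omega> * t) * r) \<gamma> (input_norm S u)"
      using c(1) d(1) M by (intro exI[of _ "8 * c * d * M"]) auto
  qed

  have exp_ISS: "exp_ISS S"
    if lin: "linear_on_nonneg \<rho>" "linear_on_nonneg \<xi>" and wrt: "exp_ISS_wrt S Uc"
  proof -
    from wrt obtain M \<omega> \<gamma> where "0 < M" and \<omega>: "0 < \<omega>" and "\<gamma> \<in> class_Kinf"
      and "\<And>x u t. u \<in> admissible S x \<inter> Uc \<Longrightarrow> 0 \<le> t \<Longrightarrow>
        norm (flow S t x u) \<le> M * exp (- \<omega> * t) * norm x + \<gamma> (input_norm S u)"
      unfolding exp_ISS_wrt_def by metis
    from exp_bound[OF lin this] \<omega> show ?thesis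
      unfolding exp_ISS_def exp_ISS_wrt_def by blast
  qed

  have exp_ISS_linear: "exp_ISS_linear_gain S"
    if lin: "linear_on_nonneg \<rho>" "linear_on_nonneg \<xi>" "linear_on_nonneg \<eta>"
      and wrt: "exp_ISS_linear_gain_wrt S Uc"
  proof -
    from wrt obtain M \<omega> \<gamma> where M: "0 < M" and \<omega>: "0 < \<omega>" and \<gamma>: "\<gamma> \<in> class_Kinf"
      and bound: "\<And>x u t. u \<in> admissible S x \<inter> Uc \<Longrightarrow> 0 \<le> t \<Longrightarrow>
        norm (flow S t x u) \<le> M * exp (- \<omega> * t) * norm x + \<gamma> (input_norm S u)"
      and \<gamma>lin: "linear_on_nonneg \<gamma>"
      unfolding exp_ISS_linear_gain_wrt_def by metis
    obtain c where c: "0 < c" "\<And>r. 0 \<le> r \<Longrightarrow> \<rho> r = c * r"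
      using class_K_linear_pos[OF K(1) lin(1)] by blast
    obtain d where d: "0 < d" "\<And>r. 0 \<le> r \<Longrightarrow> \<xi> r = d * r"
      using class_K_linear_pos[OF K(3) lin(2)] by blast
    obtain e where e: "0 < e" "\<And>r. 0 \<le> r \<Longrightarrow> \<eta> r = e * r"
      using class_K_linear_pos[OF K(2) lin(3)] by blast
    obtain g where g: "0 < g" "\<And>r. 0 \<le> r \<Longrightarrow> \<gamma> r = g * r"
      using class_K_linear_pos[OF class_Kinf_imp_K[OF \<gamma>] \<gamma>lin] by blast
    have "gain (\<lambda>r t. M * exp (- \<omega> * t) * r) \<gamma> r = (8 * c * d * M + 4 * c * g * e) * r"
      if "0 \<le> r" for r
      using that M c d e g by (simp add: gain_def algebra_simps)
    then have "linear_on_nonneg (gain (\<lambda>r t. M * exp (- \<omega> * t) * r) \<gamma>)"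
      unfolding linear_on_nonneg_def by blast
    with exp_bound[OF lin(1,2) M \<omega> \<gamma> bound] \<omega> show ?thesis
      unfolding exp_ISS_linear_gain_def exp_ISS_linear_gain_wrt_def by blast
  qed

  have "ISS S \<longleftrightarrow> ISS_wrt S Uc"
    using ISS ISS_wrt_antimono[OF _ assms(2)] unfolding ISS_def by blast
  moreover have "exp_ISS S \<Longrightarrow> exp_ISS_wrt S Uc"
    using exp_ISS_wrt_antimono[OF _ assms(2)] unfolding exp_ISS_def by blast
  ultimately show ?thesis using exp_ISS exp_ISS_linear by blast
qed

end
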